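(* Define $$E(\widehat U)=\tfrac12\left(\widehat q^{\top}\widehat u+g\|\widehat h\|^2\right)+g\,\widehat h^{\top}\widehat B,\qquad H(\widehat U)=\tfrac12\,\widehat u^{\top}\mathcal P(\widehat q)\,\widehat u+g\,\widehat q^{\top}\widehat h+g\,\widehat q^{\top}\widehat B .$$ If $\mathcal P(\widehat h)>0$ (positive definite), then $(E,H)$ is an entropy-entropy flux pair for the one-dimensional stochastic Galerkin shallow water equations $$\widehat U_t+(\widehat F(\widehat U))_x=\widehat S(\widehat U);$$ that is, $E$ is convex in $\widehat U$ and every smooth solution $\widehat U$ satisfies the companion balance law $E(\widehat U)_t+H(\widehat U)_x=0$.
   Context: Polynomial chaos setting. Let $\xi\in\mathbb R^d$ be a random variable with Lebesgue density $\rho$ having finite polynomial moments of all orders, and let $\phi_1,\dots,\phi_K$ (with $\phi_1\equiv1$) be polynomials, orthonormal for $\langle f,g\rangle_\rho=\int_{\mathbb R^d} f(s)g(s)\rho(s)\,ds$. For $\widehat z\in\mathbb R^K$ define $\mathcal P(\widehat z)=\sum_{k=1}^K\widehat z_k\mathcal M_k\in\mathbb R^{K\times K}$, where $(\mathcal M_k)_{\ell,m}=\langle\phi_k,\phi_\ell\phi_m\rangle_\rho$. The matrix $\mathcal P(\widehat z)$ is symmetric and $\mathcal P^{-1}(\widehat z)$ denotes its inverse. $\|\cdot\|$ is the Euclidean norm. Stochastic Galerkin shallow water equations (SGSWE). Let $g>0$ be a constant. The state is $\widehat U=(\widehat h^\top,\widehat q^\top)^\top\in\mathbb R^{2K}$,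 $\widehat h=\widehat h(x,t)\in\mathbb R^K$, $\widehat q=\widehat q(x,t)\in\mathbb R^K$, $x\in\mathbb R$ one-dimensional. The bottom topography coefficient vector $\widehat B=\widehat B(x)\in\mathbb R^K$ is given, smooth and independent of $t$, with $x$-derivative $\widehat{B_x}$. Velocity coefficients: $\widehat u=\mathcal P^{-1}(\widehat h)\widehat q$. The flux and source are $$\widehat F(\widehat U)=\begin{pmatrix}\widehat q\\ \mathcal P(\widehat q)\mathcal P^{-1}(\widehat h)\widehat q+\tfrac12 g\,\mathcal P(\widehat h)\widehat h\end{pmatrix},\qquad \widehat S(\widehat U)=\begin{pmatrix}0\\-g\,\mathcal P(\widehat h)\widehat{B_x}\end{pmatrix}.$$ The functions $E$ and $H$ depend on $x$ also through $\widehat B(x)$; convexity of $E$ is in $\widehat U$ for fixed $\widehat B$, on the (convex) set of $\widehat U$ with $\mathcal P(\widehat h)>0$. The companion law is equivalent to the compatibility condition $\frac{\partial E}{\partial\widehat U}\left(\frac{\partial\widehat F}{\partial\widehat U}\frac{\partial\widehat U}{\partial x}-\widehat S\right)=\frac{\partial}{\partial x}H$, where $\frac{\partial}{\partial x}H$ is the total $x$-derivative. *)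

theory Defs
  imports "HOL-Probability.Probability"
begin

section \<open>Polynomial chaos\<close>

definition weighted_inner ::
    "('a::euclidean_space \<Rightarrow> real) \<Rightarrow> ('a \<Rightarrow> real) \<Rightarrow> ('a \<Rightarrow> real) \<Rightarrow> real" where
  "weighted_inner \<rho> f g = (LINT s|lborel. f s * g s * \<rho> s)"

definition triple_product_matrix ::
    "('a::euclidean_space \<Rightarrow> real) \<Rightarrow> ('k \<Rightarrow> 'a \<Rightarrow> real) \<Rightarrow> 'k \<Rightarrow> real ^ 'k ^ 'k" where
  "triple_product_matrix \<rho> \<phi> k =
     (\<chi> l m. weighted_inner \<rho> (\<phi> k) (\<lambda>s. \<phi> l s * \<phi> m s))"

definition pc_matrix ::
    "('a::euclidean_space \<Rightarrow> real) \<Rightarrow> ('k::finite \<Rightarrow> 'a \<Rightarrow> real) \<Rightarrow> real ^ 'k \<Rightarrow> real ^ 'k ^ 'k" where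
  "pc_matrix \<rho> \<phi> z = (\<Sum>k\<in>UNIV. (z $ k) *\<^sub>R triple_product_matrix \<rho> \<phi> k)"

definition positive_definite :: "real ^ 'n ^ 'n \<Rightarrow> bool" where
  "positive_definite A \<longleftrightarrow> transpose A = A \<and> (\<forall>v. v \<noteq> 0 \<longrightarrow> 0 < v \<bullet> (A *v v))"


section \<open>One-dimensional balance laws and entropy pairs\<close>

text \<open>Points of the space-time domain are pairs \<open>(x, t)\<close>, space first.\<close>

definition C1_on :: "(real \<times> real) set \<Rightarrow> (real \<times> real \<Rightarrow> 'a::real_normed_vector) \<Rightarrow> bool" where
  "C1_on \<Omega> U \<longleftrightarrow>
     (\<exists>D :: real \<times> real \<Rightarrow> (real \<times> real) \<Rightarrow>\<^sub>L 'a.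
        (\<forall>p\<in>\<Omega>. (U has_derivative blinfun_apply (D p)) (at p)) \<and> continuous_on \<Omega> D)"

text \<open>
  \<open>W\<^sub>t + G\<^sub>x = R\<close> pointwise on \<open>\<Omega>\<close>.  The existence of both partial derivatives is part of
  the assertion.
\<close>

definition balance_law_on ::
    "(real \<times> real) set \<Rightarrow> (real \<times> real \<Rightarrow> 'a::real_normed_vector) \<Rightarrow> (real \<times> real \<Rightarrow> 'a)
      \<Rightarrow> (real \<times> real \<Rightarrow> 'a) \<Rightarrow> bool" where
  "balance_law_on \<Omega> W G R \<longleftrightarrow>
     (\<forall>x t. (x, t) \<in> \<Omega> \<longrightarrow>
        (\<exists>Wt Gx. ((\<lambda>s. W (x, s)) has_vector_derivative Wt) (at t) \<and>
                 ((\<lambda>y. G (y, t)) has_vector_derivative Gx) (at x) \<and>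
                 Wt + Gx = R (x, t)))"

text \<open>
  Classical (continuously differentiable) solutions of \<open>U\<^sub>t + F(U)\<^sub>x = S(x, U)\<close> with values in
  the admissible set \<open>A\<close>.
\<close>

definition smooth_solution ::
    "'a::real_normed_vector set \<Rightarrow> ('a \<Rightarrow> 'a) \<Rightarrow> (real \<Rightarrow> 'a \<Rightarrow> 'a)
      \<Rightarrow> (real \<times> real) set \<Rightarrow> (real \<times> real \<Rightarrow> 'a) \<Rightarrow> bool" where
  "smooth_solution A F S \<Omega> U \<longleftrightarrow>
     open \<Omega> \<and> U ` \<Omega> \<subseteq> A \<and> C1_on \<Omega> U \<and>
     balance_law_on \<Omega> U (\<lambda>p. F (U p)) (\<lambda>p. S (fst p) (U p))"

text \<open>
  The source, the entropy and the entropy flux may depend on \<open>x\<close> explicitly.  Convexity of the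
  entropy is in the state only (for fixed \<open>x\<close>); the \<open>x\<close>-derivative of the entropy flux in
  the companion law is the total derivative.
\<close>

definition entropy_pair ::
    "'a::real_normed_vector set \<Rightarrow> ('a \<Rightarrow> 'a) \<Rightarrow> (real \<Rightarrow> 'a \<Rightarrow> 'a)
      \<Rightarrow> (real \<Rightarrow> 'a \<Rightarrow> real) \<Rightarrow> (real \<Rightarrow> 'a \<Rightarrow> real) \<Rightarrow> bool" where
  "entropy_pair A F S E H \<longleftrightarrow>
     (\<forall>x. convex_on A (E x)) \<and>
     (\<forall>\<Omega> U. smooth_solution A F S \<Omega> U \<longrightarrow>
        balance_law_on \<Omega> (\<lambda>p. E (fst p) (U p)) (\<lambda>p. H (fst p) (U p)) (\<lambda>p. 0))"


section \<open>Stochastic Galerkin shallow water equations\<close>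

text \<open>
  The state in \<open>\<real>\<^sup>2\<^sup>K\<close> is the pair \<open>(h, q)\<close> of coefficient vectors.
\<close>

type_synonym 'k state = "(real ^ 'k) \<times> (real ^ 'k)"

definition sgswe_states ::
    "('a::euclidean_space \<Rightarrow> real) \<Rightarrow> ('k::finite \<Rightarrow> 'a \<Rightarrow> real) \<Rightarrow> 'k state set" where
  "sgswe_states \<rho> \<phi> = {(h, q). positive_definite (pc_matrix \<rho> \<phi> h)}"

definition sgswe_velocity ::
    "('a::euclidean_space \<Rightarrow> real) \<Rightarrow> ('k::finite \<Rightarrow> 'a \<Rightarrow> real) \<Rightarrow> 'k state \<Rightarrow> real ^ 'k" where
  "sgswe_velocity \<rho> \<phi> = (\<lambda>(h, q). matrix_inv (pc_matrix \<rho> \<phi> h) *v q)"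

definition sgswe_flux ::
    "real \<Rightarrow> ('a::euclidean_space \<Rightarrow> real) \<Rightarrow> ('k::finite \<Rightarrow> 'a \<Rightarrow> real) \<Rightarrow> 'k state \<Rightarrow> 'k state" where
  "sgswe_flux g \<rho> \<phi> = (\<lambda>(h, q).
     (q, pc_matrix \<rho> \<phi> q *v (matrix_inv (pc_matrix \<rho> \<phi> h) *v q)
           + (g / 2) *\<^sub>R (pc_matrix \<rho> \<phi> h *v h)))"

definition sgswe_source ::
    "real \<Rightarrow> ('a::euclidean_space \<Rightarrow> real) \<Rightarrow> ('k::finite \<Rightarrow> 'a \<Rightarrow> real) \<Rightarrow> (real \<Rightarrow> real ^ 'k)
      \<Rightarrow> real \<Rightarrow> 'k state \<Rightarrow> 'k state" where
  "sgswe_source g \<rho> \<phi> B x = (\<lambda>(h, q).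
     (0, - (g *\<^sub>R (pc_matrix \<rho> \<phi> h *v vector_derivative B (at x)))))"

definition sgswe_entropy ::
    "real \<Rightarrow> ('a::euclidean_space \<Rightarrow> real) \<Rightarrow> ('k::finite \<Rightarrow> 'a \<Rightarrow> real) \<Rightarrow> (real \<Rightarrow> real ^ 'k)
      \<Rightarrow> real \<Rightarrow> 'k state \<Rightarrow> real" where
  "sgswe_entropy g \<rho> \<phi> B x = (\<lambda>(h, q).
     1 / 2 * (q \<bullet> sgswe_velocity \<rho> \<phi> (h, q) + g * (norm h)\<^sup>2) + g * (h \<bullet> B x))"

definition sgswe_entropy_flux ::
    "real \<Rightarrow> ('a::euclidean_space \<Rightarrow> real) \<Rightarrow> ('k::finite \<Rightarrow> 'a \<Rightarrow> real) \<Rightarrow> (real \<Rightarrow> real ^ 'k)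
      \<Rightarrow> real \<Rightarrow> 'k state \<Rightarrow> real" where
  "sgswe_entropy_flux g \<rho> \<phi> B x = (\<lambda>(h, q).
     1 / 2 * (sgswe_velocity \<rho> \<phi> (h, q) \<bullet> (pc_matrix \<rho> \<phi> q *v sgswe_velocity \<rho> \<phi> (h, q)))
       + g * (q \<bullet> h) + g * (q \<bullet> B x))"

end

(* Convexity: the kinetic part (q . P(h)^-1 q) / 2 is the supremum over v of q . v - (v . P(h) v) / 2,
   which is linear in (h, q) because P is linear.  Companion law: only two properties of P matter,
   P(z) v = P(v) z and the symmetry of P(z).  They give u . P(h) u_x = q . u_x, so that in
   E_t + H_x all terms cancel after q_t is replaced by means of the momentum equation. *)
theory Submission
  imports Defs
begin

section \<open>Inverse matrices and the differentiation of linear systems\<close>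

text \<open>Choice makes \<open>matrix_inv A\<close> a two-sided inverse, and each part uses one of
  the two identities. The second part recognises a vector as \<open>matrix_inv A *v b\<close> by
  checking that it solves the system.\<close>

lemma matrix_inv_mult_vector:
  fixes A :: "real ^ 'n ^ 'n"
  assumes "invertible A"
  shows "A *v (matrix_inv A *v b) = b"
    and "A *v x = b \<Longrightarrow> matrix_inv A *v b = x"
proof -
  have inv: "A ** matrix_inv A = mat 1 \<and> matrix_inv A ** A = mat 1"
    using assms unfolding invertible_def matrix_inv_def by (rule someI_ex)
  then show "A *v (matrix_inv A *v b) = b"
    by (simp add: matrix_vector_mul_assoc)
  show "matrix_inv A *v b = x" if "A *v x = b"
    using inv by (simp add: matrix_vector_mul_assoc that[symmetric])
qed

lemma bounded_bilinear_matrix_vector_mult: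
  "bounded_bilinear ((*v) :: real ^ 'n ^ 'm \<Rightarrow> real ^ 'n \<Rightarrow> real ^ 'm)"
  unfolding bilinear_conv_bounded_bilinear[symmetric] bilinear_def
  by (auto intro!: linearI simp: algebra_simps scaleR_matrix_vector_assoc)

lemma differentiable_prod:
  fixes f :: "'i \<Rightarrow> 'a::real_normed_vector \<Rightarrow> 'b::real_normed_field"
  assumes "\<And>i. i \<in> I \<Longrightarrow> f i differentiable at x within S"
  shows "(\<lambda>y. \<Prod>i\<in>I. f i y) differentiable at x within S"
  using assms by (induction I rule: infinite_finite_induct) auto

text \<open>The Leibniz formula writes the determinant as a finite sum of products of
  entries.\<close>

lemma differentiable_det:
  fixes A :: "'a::real_normed_vector \<Rightarrow> real ^ 'n ^ 'n"
  assumes "\<And>i j. (\<lambda>y. A y $ i $ j) differentiable at x within S"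
  shows "(\<lambda>y. det (A y)) differentiable at x within S"
  unfolding det_def
  by (intro differentiable_sum differentiable_mult differentiable_prod differentiable_const assms ballI)
    (simp_all add: finite_permutations)

text \<open>Cramer's rule supplies the differentiability; the value of the derivative then comes from
  the product rule applied to \<open>A (matrix_inv A q) = q\<close>.\<close>

lemma has_vector_derivative_matrix_inv_mult:
  fixes A :: "real \<Rightarrow> real ^ 'n ^ 'n"
  assumes A: "(A has_vector_derivative A') (at t)"
    and q: "(q has_vector_derivative q') (at t)"
    and inv: "invertible (A t)"
  shows "((\<lambda>s. matrix_inv (A s) *v q s) has_vector_derivative
           matrix_inv (A t) *v (q' - A' *v (matrix_inv (A t) *v q t))) (at t)"
proof -
  have dA: "(\<lambda>s. A s $ i $ j) differentiable at t" for i j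
    using bounded_linear.has_vector_derivative[OF bounded_linear_vec_nth
        bounded_linear.has_vector_derivative[OF bounded_linear_vec_nth A]]
    by (rule differentiableI_vector)
  have dq: "(\<lambda>s. q s $ i) differentiable at t" for i
    using bounded_linear.has_vector_derivative[OF bounded_linear_vec_nth q]
    by (rule differentiableI_vector)
  have ddet: "(\<lambda>s. det (A s)) differentiable at t"
    by (intro differentiable_det dA)
  \<comment> \<open>The determinant is continuous at \<open>t\<close> and nonzero there, so Cramer's
    rule is available in a whole neighbourhood.\<close>
  have "\<forall>\<^sub>F s in at t. det (A s) \<noteq> 0"
    using differentiable_imp_continuous_within[OF ddet] inv
    by (intro tendsto_imp_eventually_ne[where c = "det (A t)"])
      (auto simp: continuous_within invertible_det_nz)
  then have ev: "\<forall>\<^sub>F s in nhds t. invertible (A s)"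
    using inv by (simp add: eventually_nhds_conv_at invertible_det_nz)
  \<comment> \<open>Cramer's quotients: column \<open>k\<close> of \<open>A s\<close> is replaced by
    \<open>q s\<close>.\<close>
  define c where "c s = (\<chi> k. det (\<chi> i j. if j = k then q s $ i else A s $ i $ j) / det (A s))" for s
  have c: "matrix_inv (A s) *v q s = c s" if "invertible (A s)" for s
    using that cramer[of "A s"] matrix_inv_mult_vector(1)[OF that]
    by (auto simp: c_def invertible_det_nz)
  have "(\<lambda>s. det (\<chi> i j. if j = k then q s $ i else A s $ i $ j)) differentiable at t" for k
  proof (rule differentiable_det)
    show "(\<lambda>s. (\<chi> i j. if j = k then q s $ i else A s $ i $ j) $ i $ j) differentiable at t" for i j
      by (cases "j = k") (simp_all add: dA dq)
  qed
  then have "(\<lambda>s. c s \<bullet> axis k 1) differentiable at t" for k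
    using ddet inv by (simp add: c_def inner_axis invertible_det_nz)
  then have "c differentiable at t"
    unfolding differentiable_componentwise_within[where f = c] by (auto simp: Basis_vec_def)
  then obtain c' where c': "(c has_vector_derivative c') (at t)"
    using vector_derivative_works by blast
  have u: "((\<lambda>s. matrix_inv (A s) *v q s) has_vector_derivative c') (at t)"
    using ev c inv
    by (subst has_vector_derivative_cong_ev[where g = c])
      (auto intro: c' elim!: eventually_mono)
  \<comment> \<open>The same function is differentiated twice, by the product rule and as a function
    equal to \<open>q\<close> near \<open>t\<close>. Uniqueness of the derivative then gives a
    linear system for \<open>c'\<close>.\<close>
  have "((\<lambda>s. A s *v (matrix_inv (A s) *v q s)) has_vector_derivative
          A t *v c' + A' *v (matrix_inv (A t) *v q t)) (at t)"
    by (rule bounded_bilinear.has_vector_derivative[OF bounded_bilinear_matrix_vector_mult A u])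
  moreover have "((\<lambda>s. A s *v (matrix_inv (A s) *v q s)) has_vector_derivative q') (at t)"
    using ev inv
    by (subst has_vector_derivative_cong_ev[where g = q])
      (auto intro: q elim!: eventually_mono simp: matrix_inv_mult_vector(1))
  ultimately have "A t *v c' + A' *v (matrix_inv (A t) *v q t) = q'"
    by (rule vector_derivative_unique_at)
  then have "A t *v c' = q' - A' *v (matrix_inv (A t) *v q t)"
    by (simp add: algebra_simps)
  then show ?thesis
    using u matrix_inv_mult_vector(2)[OF inv] by metis
qed

section \<open>Positive definite matrices\<close>

text \<open>If \<open>A\<close> maps two vectors to the same value, its quadratic form vanishes at
  their difference. So \<open>A\<close> is injective, which suffices for a square matrix.\<close>

lemma positive_definite_invertible:
  assumes "positive_definite A"
  shows "invertible A"
proof -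
  have "inj ((*v) A)"
  proof (rule injI)
    fix x y assume "A *v x = A *v y"
    then have "(x - y) \<bullet> (A *v (x - y)) = 0" by (simp add: algebra_simps)
    then show "x = y"
      using assms by (metis eq_iff_diff_eq_0 less_irrefl positive_definite_def)
  qed
  then show ?thesis
    using invertible_left_inverse matrix_left_invertible_injective by blast
qed

lemma positive_definite_nonneg:
  "positive_definite A \<Longrightarrow> 0 \<le> v \<bullet> (A *v v)"
  by (cases "v = 0") (auto simp: positive_definite_def less_imp_le)

text \<open>Completing the square: with \<open>u = matrix_inv A *v q\<close>, right side minus left
  side is the quadratic form of \<open>A\<close> at \<open>u - v\<close>. Equality holds at
  \<open>v = u\<close>, so the right side is a maximum over \<open>v\<close>.\<close>

lemma positive_definite_matrix_inv_inner_ge: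
  fixes A :: "real ^ 'n ^ 'n"
  assumes "positive_definite A"
  shows "2 * (q \<bullet> v) - v \<bullet> (A *v v) \<le> q \<bullet> (matrix_inv A *v q)"
proof -
  define u where "u = matrix_inv A *v q"
  have q: "A *v u = q"
    using matrix_inv_mult_vector(1)[OF positive_definite_invertible[OF assms]]
    by (simp add: u_def)
  have sym: "x \<bullet> (A *v y) = (A *v x) \<bullet> y" for x y
    using assms by (metis dot_lmul_matrix positive_definite_def transpose_matrix_vector)
  have "0 \<le> (u - v) \<bullet> (A *v (u - v))"
    by (rule positive_definite_nonneg[OF assms])
  also have "\<dots> = q \<bullet> u - 2 * (q \<bullet> v) + v \<bullet> (A *v v)"
    using sym[of v u] sym[of u v] by (simp add: algebra_simps inner_commute q)
  finally show ?thesis by (simp add: u_def)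
qed

section \<open>Linearity and symmetries of the polynomial chaos matrix\<close>

lemma bounded_linear_pc_matrix: "bounded_linear (pc_matrix \<rho> \<phi>)"
  unfolding linear_conv_bounded_linear[symmetric] pc_matrix_def
  by (rule linearI) (simp_all add: scaleR_add_left sum.distrib scaleR_sum_right)

lemma pc_matrix_mult_eq:
  "(pc_matrix \<rho> \<phi> z *v v) $ l =
     (\<Sum>m\<in>UNIV. \<Sum>k\<in>UNIV. z $ k * v $ m * weighted_inner \<rho> (\<phi> k) (\<lambda>s. \<phi> l s * \<phi> m s))"
  by (simp add: matrix_vector_mult_def pc_matrix_def triple_product_matrix_def
      sum_distrib_right sum_distrib_left mult_ac)

lemma transpose_pc_matrix: "transpose (pc_matrix \<rho> \<phi> z) = pc_matrix \<rho> \<phi> z"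
  by (simp add: vec_eq_iff transpose_def pc_matrix_def triple_product_matrix_def mult_ac)

text \<open>The integral of \<open>\<phi> k * \<phi> l * \<phi> m * \<rho>\<close> is symmetric in
  \<open>k\<close> and \<open>m\<close>, so exchanging the two sums exchanges the roles of
  \<open>z\<close> and \<open>v\<close>.\<close>

lemma pc_matrix_mult_commute: "pc_matrix \<rho> \<phi> z *v v = pc_matrix \<rho> \<phi> v *v z"
  unfolding vec_eq_iff pc_matrix_mult_eq
  by (subst sum.swap) (simp add: weighted_inner_def mult_ac)

lemma pc_matrix_inner_commute: "x \<bullet> (pc_matrix \<rho> \<phi> z *v y) = y \<bullet> (pc_matrix \<rho> \<phi> z *v x)"
  by (metis dot_lmul_matrix inner_commute transpose_matrix_vector transpose_pc_matrix)

text \<open>The symmetric matrix moves onto the velocity, which it maps to \<open>q\<close>.\<close>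

lemma sgswe_velocity_inner_pc_matrix_mult:
  assumes "(h, q) \<in> sgswe_states \<rho> \<phi>"
  shows "sgswe_velocity \<rho> \<phi> (h, q) \<bullet> (pc_matrix \<rho> \<phi> h *v v) = q \<bullet> v"
proof -
  have "pc_matrix \<rho> \<phi> h *v sgswe_velocity \<rho> \<phi> (h, q) = q"
    using assms
    by (simp add: sgswe_states_def sgswe_velocity_def matrix_inv_mult_vector(1)
        positive_definite_invertible)
  then show ?thesis
    using pc_matrix_inner_commute[of "sgswe_velocity \<rho> \<phi> (h, q)" \<rho> \<phi> h v]
    by (simp add: inner_commute)
qed

section \<open>Convexity of the admissible set and of the entropy\<close>

text \<open>For fixed \<open>v\<close> the quadratic form of
  \<open>pc_matrix \<rho> \<phi> h\<close> is linear in \<open>h\<close>, so its positivity passes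
  to convex combinations.\<close>

lemma convex_sgswe_states:
  fixes \<rho> :: "'a::euclidean_space \<Rightarrow> real" and \<phi> :: "'k::finite \<Rightarrow> 'a \<Rightarrow> real"
  shows "convex (sgswe_states \<rho> \<phi>)"
proof (rule convexI)
  fix X Y :: "'k state" and a b :: real
  assume X: "X \<in> sgswe_states \<rho> \<phi>" and Y: "Y \<in> sgswe_states \<rho> \<phi>"
    and ab: "0 \<le> a" "0 \<le> b" "a + b = 1"
  interpret P: bounded_linear "pc_matrix \<rho> \<phi>" by (rule bounded_linear_pc_matrix)
  obtain h q h' q' where XY: "X = (h, q)" "Y = (h', q')" by fastforce
  have "0 < v \<bullet> (pc_matrix \<rho> \<phi> (a *\<^sub>R h + b *\<^sub>R h') *v v)" if "v \<noteq> 0" for v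
  proof -
    have 1: "0 < v \<bullet> (pc_matrix \<rho> \<phi> h *v v)" "0 < v \<bullet> (pc_matrix \<rho> \<phi> h' *v v)"
      using X Y that by (auto simp: XY sgswe_states_def positive_definite_def)
    \<comment> \<open>If \<open>a = 0\<close>, then \<open>b = 1\<close>; otherwise the first
      summand is already positive.\<close>
    have "0 < a * (v \<bullet> (pc_matrix \<rho> \<phi> h *v v)) + b * (v \<bullet> (pc_matrix \<rho> \<phi> h' *v v))"
      using 1 ab by (cases "a = 0") (auto intro: add_pos_nonneg)
    then show ?thesis
      by (simp add: P.add P.scaleR matrix_vector_mult_add_rdistrib inner_add_right
          flip: scaleR_matrix_vector_assoc)
  qed
  then show "a *\<^sub>R X + b *\<^sub>R Y \<in> sgswe_states \<rho> \<phi>"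
    by (simp add: XY sgswe_states_def positive_definite_def transpose_pc_matrix)
qed

lemma convex_on_sgswe_entropy:
  fixes \<rho> :: "'a::euclidean_space \<Rightarrow> real" and \<phi> :: "'k::finite \<Rightarrow> 'a \<Rightarrow> real"
  assumes "g \<ge> 0"
  shows "convex_on (sgswe_states \<rho> \<phi>) (sgswe_entropy g \<rho> \<phi> B x)"
proof (rule convex_onI[OF _ convex_sgswe_states])
  fix t :: real and X Y :: "'k state"
  assume t: "t > 0" "t < 1" and X: "X \<in> sgswe_states \<rho> \<phi>" and Y: "Y \<in> sgswe_states \<rho> \<phi>"
  interpret P: bounded_linear "pc_matrix \<rho> \<phi>" by (rule bounded_linear_pc_matrix)
  obtain h q h' q' where XY: "X = (h, q)" "Y = (h', q')" by fastforce
  define h0 where "h0 = (1 - t) *\<^sub>R h + t *\<^sub>R h'"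
  define q0 where "q0 = (1 - t) *\<^sub>R q + t *\<^sub>R q'"
  \<comment> \<open>The maximiser of the variational formula at the intermediate state
    \<open>(h0, q0)\<close>; it is kept fixed below.\<close>
  define u where "u = matrix_inv (pc_matrix \<rho> \<phi> h0) *v q0"
  have "(h0, q0) \<in> sgswe_states \<rho> \<phi>"
    using convexD[OF convex_sgswe_states X Y, of "1 - t" t] t by (simp add: XY h0_def q0_def)
  then have "pc_matrix \<rho> \<phi> h0 *v u = q0"
    unfolding u_def
    by (intro matrix_inv_mult_vector positive_definite_invertible)
      (simp add: sgswe_states_def)
  then have "q0 \<bullet> u = 2 * (q0 \<bullet> u) - u \<bullet> (pc_matrix \<rho> \<phi> h0 *v u)"
    by (simp add: inner_commute)
  \<comment> \<open>For fixed \<open>u\<close> the expression is linear in the state, so it splits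
    along the convex combination.\<close>
  also have "\<dots> = (1 - t) * (2 * (q \<bullet> u) - u \<bullet> (pc_matrix \<rho> \<phi> h *v u))
      + t * (2 * (q' \<bullet> u) - u \<bullet> (pc_matrix \<rho> \<phi> h' *v u))"
    unfolding h0_def q0_def
    by (simp only: P.add P.scaleR matrix_vector_mult_add_rdistrib inner_add_right inner_add_left
          scaleR_matrix_vector_assoc[symmetric] inner_scaleR_left inner_scaleR_right)
       (simp add: algebra_simps)
  \<comment> \<open>At the two endpoints \<open>u\<close> is only a competitor in the
    maximum.\<close>
  also have "\<dots> \<le> (1 - t) * (q \<bullet> (matrix_inv (pc_matrix \<rho> \<phi> h) *v q))
      + t * (q' \<bullet> (matrix_inv (pc_matrix \<rho> \<phi> h') *v q'))"
    using X Y t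
    by (intro add_mono mult_left_mono positive_definite_matrix_inv_inner_ge)
      (auto simp: XY sgswe_states_def)
  finally have kin: "q0 \<bullet> u \<le> \<dots>" .
  \<comment> \<open>The exact convexity defect of the squared norm.\<close>
  have "(1 - t) * (norm h)\<^sup>2 + t * (norm h')\<^sup>2 - (norm h0)\<^sup>2 = t * (1 - t) * (norm (h - h'))\<^sup>2"
    unfolding h0_def power2_norm_eq_inner
    by (simp add: inner_add_left inner_add_right inner_diff_left inner_diff_right inner_commute)
       (simp add: algebra_simps)
  also have "\<dots> \<ge> 0" using t by simp
  finally have "g * (norm h0)\<^sup>2 \<le> g * ((1 - t) * (norm h)\<^sup>2 + t * (norm h')\<^sup>2)"
    using assms by (intro mult_left_mono) auto
  moreover have "h0 \<bullet> B x = (1 - t) * (h \<bullet> B x) + t * (h' \<bullet> B x)"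
    by (simp add: h0_def inner_add_left)
  ultimately have "sgswe_entropy g \<rho> \<phi> B x (h0, q0)
      \<le> (1 - t) * sgswe_entropy g \<rho> \<phi> B x X + t * sgswe_entropy g \<rho> \<phi> B x Y"
    using kin unfolding sgswe_entropy_def sgswe_velocity_def XY
    by (simp add: u_def[symmetric]) (simp add: algebra_simps add_divide_distrib diff_divide_distrib)
  then show "sgswe_entropy g \<rho> \<phi> B x ((1 - t) *\<^sub>R X + t *\<^sub>R Y)
      \<le> (1 - t) * sgswe_entropy g \<rho> \<phi> B x X + t * sgswe_entropy g \<rho> \<phi> B x Y"
    by (simp add: XY h0_def q0_def)
qed

section \<open>Derivatives of velocity, entropy and fluxes along curves\<close>

lemma bounded_bilinear_pc_matrix_mult:
  "bounded_bilinear (\<lambda>z v. pc_matrix \<rho> \<phi> z *v v)"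
  by (rule bounded_bilinear.comp1[OF bounded_bilinear_matrix_vector_mult bounded_linear_pc_matrix])

text \<open>The second property is the differentiated relation between velocity and discharge.
  Characterising \<open>u'\<close> this way keeps \<open>matrix_inv\<close> out of the later
  computations.\<close>

lemma has_vector_derivative_sgswe_velocity:
  assumes h: "(h has_vector_derivative h') (at t)"
    and q: "(q has_vector_derivative q') (at t)"
    and adm: "(h t, q t) \<in> sgswe_states \<rho> \<phi>"
  obtains u' where
    "((\<lambda>s. sgswe_velocity \<rho> \<phi> (h s, q s)) has_vector_derivative u') (at t)"
    "pc_matrix \<rho> \<phi> (h t) *v u' = q' - pc_matrix \<rho> \<phi> h' *v sgswe_velocity \<rho> \<phi> (h t, q t)"
proof -
  have inv: "invertible (pc_matrix \<rho> \<phi> (h t))"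
    using adm by (simp add: sgswe_states_def positive_definite_invertible)
  show ?thesis
  proof (rule that)
    show "((\<lambda>s. sgswe_velocity \<rho> \<phi> (h s, q s)) has_vector_derivative
            matrix_inv (pc_matrix \<rho> \<phi> (h t)) *v
              (q' - pc_matrix \<rho> \<phi> h' *v sgswe_velocity \<rho> \<phi> (h t, q t))) (at t)"
      unfolding sgswe_velocity_def prod.case
      by (intro has_vector_derivative_matrix_inv_mult q inv
          bounded_linear.has_vector_derivative[OF bounded_linear_pc_matrix h])
  qed (rule matrix_inv_mult_vector(1)[OF inv])
qed

text \<open>The symmetry of the triple product turns \<open>q \<bullet> u\<^sub>t\<close> into \<open>u \<bullet> P(h) u\<^sub>t = u \<bullet> (q\<^sub>t - P(h\<^sub>t) u)\<close>,
  so the derivative of the entropy does not involve the derivative of the velocity.\<close>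

lemma has_vector_derivative_sgswe_entropy:
  assumes h: "(h has_vector_derivative h') (at t)"
    and q: "(q has_vector_derivative q') (at t)"
    and adm: "(h t, q t) \<in> sgswe_states \<rho> \<phi>"
  defines "u \<equiv> sgswe_velocity \<rho> \<phi> (h t, q t)"
  shows "((\<lambda>s. sgswe_entropy g \<rho> \<phi> B x (h s, q s)) has_vector_derivative
           u \<bullet> q' - 1 / 2 * (u \<bullet> (pc_matrix \<rho> \<phi> h' *v u)) + g * (h t \<bullet> h') + g * (h' \<bullet> B x)) (at t)"
proof -
  note inner = bounded_bilinear.has_vector_derivative[OF bounded_bilinear_inner]
  obtain u' where u': "((\<lambda>s. sgswe_velocity \<rho> \<phi> (h s, q s)) has_vector_derivative u') (at t)"
    and Pu': "pc_matrix \<rho> \<phi> (h t) *v u' = q' - pc_matrix \<rho> \<phi> h' *v u"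
    unfolding u_def by (rule has_vector_derivative_sgswe_velocity[OF h q adm])
  have qu': "q t \<bullet> u' = u \<bullet> q' - u \<bullet> (pc_matrix \<rho> \<phi> h' *v u)"
    using sgswe_velocity_inner_pc_matrix_mult[OF adm, of u']
    by (simp add: Pu' inner_diff_right flip: u_def)
  \<comment> \<open>The \<open>0\<close> is the derivative of \<open>B x\<close>: the point
    \<open>x\<close> is fixed while the state moves.\<close>
  have "((\<lambda>s. sgswe_entropy g \<rho> \<phi> B x (h s, q s)) has_vector_derivative
      1 / 2 * ((q t \<bullet> u' + q' \<bullet> u) + g * (h t \<bullet> h' + h' \<bullet> h t)) + g * (h t \<bullet> 0 + h' \<bullet> B x)) (at t)"
    unfolding sgswe_entropy_def prod.case power2_norm_eq_inner u_def
    by (intro has_vector_derivative_add has_vector_derivative_mult_right inner h q u'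
        has_vector_derivative_const)
  then show ?thesis
    by (rule has_vector_derivative_eq_rhs)
      (simp add: qu' inner_commute[of q' u] inner_commute[of h' "h t"] field_simps)
qed

text \<open>By symmetry of the matrix the two terms containing \<open>u'\<close> coincide, which
  absorbs the factor 1/2. Here \<open>y\<close> also moves inside \<open>B\<close>, so this is the
  total derivative.\<close>

lemma has_vector_derivative_sgswe_entropy_flux:
  assumes h: "(h has_vector_derivative h') (at y)"
    and q: "(q has_vector_derivative q') (at y)"
    and u: "((\<lambda>y. sgswe_velocity \<rho> \<phi> (h y, q y)) has_vector_derivative u') (at y)"
    and B: "(B has_vector_derivative B') (at y)"
  defines "u \<equiv> sgswe_velocity \<rho> \<phi> (h y, q y)"
  shows "((\<lambda>y. sgswe_entropy_flux g \<rho> \<phi> B y (h y, q y)) has_vector_derivative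
           u \<bullet> (pc_matrix \<rho> \<phi> (q y) *v u') + 1 / 2 * (u \<bullet> (pc_matrix \<rho> \<phi> q' *v u))
           + g * (q y \<bullet> h' + q' \<bullet> h y) + g * (q y \<bullet> B' + q' \<bullet> B y)) (at y)"
proof -
  note inner = bounded_bilinear.has_vector_derivative[OF bounded_bilinear_inner]
  note pc = bounded_bilinear.has_vector_derivative[OF bounded_bilinear_pc_matrix_mult]
  have "((\<lambda>y. sgswe_entropy_flux g \<rho> \<phi> B y (h y, q y)) has_vector_derivative
      1 / 2 * (u \<bullet> (pc_matrix \<rho> \<phi> (q y) *v u' + pc_matrix \<rho> \<phi> q' *v u)
          + u' \<bullet> (pc_matrix \<rho> \<phi> (q y) *v u))
        + g * (q y \<bullet> h' + q' \<bullet> h y) + g * (q y \<bullet> B' + q' \<bullet> B y)) (at y)"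
    unfolding sgswe_entropy_flux_def prod.case u_def
    by (intro has_vector_derivative_add has_vector_derivative_mult_right inner pc h q u B)
  then show ?thesis
    by (rule has_vector_derivative_eq_rhs)
      (simp add: inner_add_right pc_matrix_inner_commute[of u'] field_simps)
qed

lemma has_vector_derivative_sgswe_flux:
  assumes h: "(h has_vector_derivative h') (at y)"
    and q: "(q has_vector_derivative q') (at y)"
    and u: "((\<lambda>y. sgswe_velocity \<rho> \<phi> (h y, q y)) has_vector_derivative u') (at y)"
  defines "u \<equiv> sgswe_velocity \<rho> \<phi> (h y, q y)"
  shows "((\<lambda>y. sgswe_flux g \<rho> \<phi> (h y, q y)) has_vector_derivative
           (q', pc_matrix \<rho> \<phi> (q y) *v u' + pc_matrix \<rho> \<phi> q' *v u
                + g *\<^sub>R (pc_matrix \<rho> \<phi> (h y) *v h'))) (at y)"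
proof -
  note pc = bounded_bilinear.has_vector_derivative[OF bounded_bilinear_pc_matrix_mult]
  have "((\<lambda>y. (q y, pc_matrix \<rho> \<phi> (q y) *v sgswe_velocity \<rho> \<phi> (h y, q y)
               + (g / 2) *\<^sub>R (pc_matrix \<rho> \<phi> (h y) *v h y))) has_vector_derivative
      (q', (pc_matrix \<rho> \<phi> (q y) *v u' + pc_matrix \<rho> \<phi> q' *v u)
        + (g / 2) *\<^sub>R (pc_matrix \<rho> \<phi> (h y) *v h' + pc_matrix \<rho> \<phi> h' *v h y))) (at y)"
    unfolding u_def
    by (intro has_vector_derivative_add has_vector_derivative_Pair pc h q u
        bounded_linear.has_vector_derivative[OF bounded_linear_scaleR_right])
  \<comment> \<open>The two product-rule terms agree because matrix index and argument commute;
    hence \<open>g / 2\<close> becomes \<open>g\<close>.\<close>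
  moreover have "(g / 2) *\<^sub>R (pc_matrix \<rho> \<phi> (h y) *v h' + pc_matrix \<rho> \<phi> h' *v h y)
      = g *\<^sub>R (pc_matrix \<rho> \<phi> (h y) *v h')"
    by (simp add: pc_matrix_mult_commute[of \<rho> \<phi> h'] flip: scaleR_2)
  ultimately show ?thesis
    by (simp add: sgswe_flux_def sgswe_velocity_def)
qed

section \<open>Smooth solutions and the companion law\<close>

text \<open>The balance law only provides an \<open>x\<close>-derivative of the flux along the
  solution. That of the state itself comes from the total derivative, by the chain rule along a
  horizontal line.\<close>

lemma C1_on_has_vector_derivative_fst:
  assumes "C1_on \<Omega> U" "(x, t) \<in> \<Omega>"
  obtains U' where "((\<lambda>y. U (y, t)) has_vector_derivative U') (at x)"
proof -
  obtain D where "(U has_derivative D) (at (x, t))"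
    using assms by (auto simp: C1_on_def)
  then have "((\<lambda>y. U (y, t)) has_derivative (\<lambda>s. D (s, 0))) (at x)"
    by (rule has_derivative_compose[rotated]) (auto intro!: derivative_eq_intros)
  then show ?thesis
    using that vector_derivative_works differentiableI by blast
qed

theorem theorem3p1:
  fixes M :: "'w measure"
    and \<xi> :: "'w \<Rightarrow> real ^ 'd"
    and \<rho> :: "real ^ 'd \<Rightarrow> real"
    and \<phi> :: "'k::finite \<Rightarrow> real ^ 'd \<Rightarrow> real"
    and k1 :: 'k
    and g :: real
    and B :: "real \<Rightarrow> real ^ 'k"
  assumes "prob_space M"
    and "\<And>s. \<rho> s \<ge> 0"
    and "distributed M lborel \<xi> (\<lambda>s. ennreal (\<rho> s))"
    and "\<And>p. real_polynomial_function p \<Longrightarrow> integrable lborel (\<lambda>s. p s * \<rho> s)"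
    and "\<And>k. real_polynomial_function (\<phi> k)"
    and "\<phi> k1 = (\<lambda>s. 1)"
    and "\<And>k l. weighted_inner \<rho> (\<phi> k) (\<phi> l) = (if k = l then 1 else 0)"
    and "g > 0"
    and "B C1_differentiable_on UNIV"
  shows "entropy_pair (sgswe_states \<rho> \<phi>) (sgswe_flux g \<rho> \<phi>) (sgswe_source g \<rho> \<phi> B)
           (sgswe_entropy g \<rho> \<phi> B) (sgswe_entropy_flux g \<rho> \<phi> B)"
proof -
  have vdB: "(B has_vector_derivative vector_derivative B (at x)) (at x)" for x
    using assms(9) by (simp add: C1_differentiable_on_eq vector_derivative_works)
  have "balance_law_on \<Omega> (\<lambda>p. sgswe_entropy g \<rho> \<phi> B (fst p) (U p))
          (\<lambda>p. sgswe_entropy_flux g \<rho> \<phi> B (fst p) (U p)) (\<lambda>p. 0)"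
    if sol: "smooth_solution (sgswe_states \<rho> \<phi>) (sgswe_flux g \<rho> \<phi>) (sgswe_source g \<rho> \<phi> B) \<Omega> U"
    for \<Omega> U
    unfolding balance_law_on_def
  proof (intro allI impI)
    fix x t assume xt: "(x, t) \<in> \<Omega>"
    define h where "h = (\<lambda>p. fst (U p))"
    define q where "q = (\<lambda>p. snd (U p))"
    define u where "u = sgswe_velocity \<rho> \<phi> (h (x, t), q (x, t))"
    have U: "U = (\<lambda>p. (h p, q p))" by (simp add: h_def q_def)
    have adm: "(h (x, t), q (x, t)) \<in> sgswe_states \<rho> \<phi>"
      using sol xt by (auto simp: smooth_solution_def h_def q_def)
    note fst = bounded_linear.has_vector_derivative[OF bounded_linear_fst]
    note snd = bounded_linear.has_vector_derivative[OF bounded_linear_snd]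
    have "balance_law_on \<Omega> U (\<lambda>p. sgswe_flux g \<rho> \<phi> (U p)) (\<lambda>p. sgswe_source g \<rho> \<phi> B (fst p) (U p))"
      and C1: "C1_on \<Omega> U"
      using sol by (simp_all add: smooth_solution_def)
    then obtain Ut Fx where Ut: "((\<lambda>s. U (x, s)) has_vector_derivative Ut) (at t)"
      and Fx: "((\<lambda>y. sgswe_flux g \<rho> \<phi> (U (y, t))) has_vector_derivative Fx) (at x)"
      and eq: "Ut + Fx = sgswe_source g \<rho> \<phi> B x (U (x, t))"
      unfolding balance_law_on_def fst_conv using xt by blast
    obtain Ux where Ux: "((\<lambda>y. U (y, t)) has_vector_derivative Ux) (at x)"
      by (rule C1_on_has_vector_derivative_fst[OF C1 xt])
    obtain ht qt hx qx where split: "Ut = (ht, qt)" "Ux = (hx, qx)" by fastforce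
    have h_t: "((\<lambda>s. h (x, s)) has_vector_derivative ht) (at t)"
      and q_t: "((\<lambda>s. q (x, s)) has_vector_derivative qt) (at t)"
      and h_x: "((\<lambda>y. h (y, t)) has_vector_derivative hx) (at x)"
      and q_x: "((\<lambda>y. q (y, t)) has_vector_derivative qx) (at x)"
      using fst[OF Ut] snd[OF Ut] fst[OF Ux] snd[OF Ux] by (simp_all add: h_def q_def split)
    obtain ux where u_x: "((\<lambda>y. sgswe_velocity \<rho> \<phi> (h (y, t), q (y, t))) has_vector_derivative ux) (at x)"
      using has_vector_derivative_sgswe_velocity[OF h_x q_x adm] .
    \<comment> \<open>The derivative supplied by the balance law must equal the one computed from
      \<open>hx\<close>, \<open>qx\<close> and \<open>ux\<close>.\<close>
    have "Fx = (qx, pc_matrix \<rho> \<phi> (q (x, t)) *v ux + pc_matrix \<rho> \<phi> qx *v u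
                + g *\<^sub>R (pc_matrix \<rho> \<phi> (h (x, t)) *v hx))"
      using vector_derivative_unique_at[OF Fx[unfolded U] has_vector_derivative_sgswe_flux[OF h_x q_x u_x]]
      by (simp add: u_def)
    \<comment> \<open>The mass and momentum components, solved for the time derivatives.\<close>
    with eq have ht: "ht = - qx"
      and qt: "qt = - (pc_matrix \<rho> \<phi> (q (x, t)) *v ux) - pc_matrix \<rho> \<phi> qx *v u
                - g *\<^sub>R (pc_matrix \<rho> \<phi> (h (x, t)) *v hx)
                - g *\<^sub>R (pc_matrix \<rho> \<phi> (h (x, t)) *v vector_derivative B (at x))"
      by (auto simp: U split sgswe_source_def eq_neg_iff_add_eq_0 algebra_simps)
    have Pu: "u \<bullet> (pc_matrix \<rho> \<phi> (h (x, t)) *v v) = q (x, t) \<bullet> v" for v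
      unfolding u_def by (rule sgswe_velocity_inner_pc_matrix_mult[OF adm])
    have neg: "pc_matrix \<rho> \<phi> (- qx) *v u = - (pc_matrix \<rho> \<phi> qx *v u)"
      by (rule bounded_bilinear.minus_left[OF bounded_bilinear_pc_matrix_mult])
    \<comment> \<open>The term \<open>u \<bullet> (pc_matrix \<rho> \<phi> qx *v u)\<close> occurs
      with coefficient -1 from \<open>qt\<close>, 1/2 from \<open>ht = - qx\<close> and 1/2 from the
      flux. The terms in \<open>ux\<close> cancel directly, and all terms with \<open>g\<close>
      cancel by \<open>Pu\<close> and \<open>ht = - qx\<close>.\<close>
    have "(u \<bullet> qt - 1 / 2 * (u \<bullet> (pc_matrix \<rho> \<phi> ht *v u)) + g * (h (x, t) \<bullet> ht) + g * (ht \<bullet> B x))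
        + (u \<bullet> (pc_matrix \<rho> \<phi> (q (x, t)) *v ux) + 1 / 2 * (u \<bullet> (pc_matrix \<rho> \<phi> qx *v u))
           + g * (q (x, t) \<bullet> hx + qx \<bullet> h (x, t))
           + g * (q (x, t) \<bullet> vector_derivative B (at x) + qx \<bullet> B x)) = 0"
      unfolding ht qt neg
      by (simp add: inner_diff_right Pu inner_commute[of qx "h (x, t)"]) (simp add: algebra_simps)
    then show "\<exists>Wt Gx.
        ((\<lambda>s. sgswe_entropy g \<rho> \<phi> B (fst (x, s)) (U (x, s))) has_vector_derivative Wt) (at t) \<and>
        ((\<lambda>y. sgswe_entropy_flux g \<rho> \<phi> B (fst (y, t)) (U (y, t))) has_vector_derivative Gx) (at x) \<and>
        Wt + Gx = 0"
      using has_vector_derivative_sgswe_entropy[OF h_t q_t adm, of g B x]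
        has_vector_derivative_sgswe_entropy_flux[OF h_x q_x u_x vdB, of g]
      unfolding U u_def[symmetric] fst_conv by blast
  qed
  then show ?thesis
    using convex_on_sgswe_entropy[OF less_imp_le[OF assms(8)]] unfolding entropy_pair_def by blast
qed

end
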